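(* Let $r\geq 1$, and let $f_1,\dots,f_r\colon X\to Y$ be fibrewise pointed maps between fibrewise pointed spaces over $B$ which are fibrant. If, in addition, $X$ and $Y$ are ANR spaces and $B$ is locally equiconnected, then $$D_B(f_1,\dots,f_r)\le D_B^B(f_1,\dots,f_r)\le D_B(f_1,\dots,f_r)+1.$$
   Context: All spaces are topological spaces, all maps are continuous, $I=[0,1]$. A fibrewise space over $B$ is a space $X$ with a map $p_X\colon X\to B$; it is fibrant if $p_X$ is a Hurewicz fibration. A fibrewise map $f\colon X\to Y$ satisfies $p_Y\circ f=p_X$; $f\simeq_B g$ means there is $H\colon X\times I\to Y$ with $p_Y(H(x,t))=p_X(x)$, $H(\cdot,0)=f$, $H(\cdot,1)=g$. A fibrewise pointed space is a fibrewise space $X$ with a section $s_X\colon B\to X$ of $p_X$; a fibrewise pointed map is a fibrewise map with $f\circ s_X=s_Y$; $f\simeq_B^B g$ means there is a fibrewise homotopy $H$ from $f$ to $g$ with $H(s_X(b),t)=s_Y(b)$ for all $b\in B$, $t\in I$. A subspace containing $s_X(B)$ is a fibrewise pointed space. $D_B(f_1,\dots,f_r)$ is the least $n\ge 0$ (or $\infty$) such that $X$ has an open cover $\{U_0,\dots,U_n\}$ with $f_s|_{U_i}\simeq_B f_t|_{U_i}$ for all $i,s,t$. $D_B^B(f_1,\dots,f_r)$ is the least $n\ge 0$ (or $\infty$) such that $X$ has an open cover $\{U_0,\dots,U_n\}$ with $s_X(B)\subset U_i$ and $f_1|_{U_i}\simeq_B^B\cdots\simeq_B^B f_r|_{U_i}$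 for all $i$. ANR means absolute neighbourhood retract (for metrizable spaces); $B$ is locally equiconnected if the diagonal $B\to B\times B$ is a closed cofibration. *)

theory Defs
  imports "HOL-Analysis.Analysis" "HOL-Library.Extended_Nat"
begin

text \<open>
  Spaces are abstract topologies \<open>'a topology\<close>, possibly with empty carrier; maps are only
  relevant on the \<open>topspace\<close> of their domain.

  Three of the notions below quantify over all spaces of some kind, which in HOL has to be
  done over the topologies on one fixed type. In each case that type is large enough to carry
  a universal test space, so nothing is lost.
\<close>

abbreviation unit_interval :: "real topology" where
  "unit_interval \<equiv> top_of_set {0..1}"

text \<open>
  Homotopy lifting property. The universal test space is the mapping path space
  \<open>{(e, \<gamma>). \<gamma> 0 = p e}\<close> with the topology induced from the product of \<open>E\<close> and the
  path space of \<open>B\<close> (compact-open topology); it lives on the type \<open>'e \<times> (real \<Rightarrow> 'b)\<close>.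
\<close>

definition hurewicz_fibration ::
    "'e topology \<Rightarrow> 'b topology \<Rightarrow> ('e \<Rightarrow> 'b) \<Rightarrow> bool" where
  "hurewicz_fibration E B p \<longleftrightarrow>
     continuous_map E B p \<and>
     (\<forall>(Z :: ('e \<times> (real \<Rightarrow> 'b)) topology) g H.
        continuous_map Z E g \<and>
        continuous_map (prod_topology Z unit_interval) B H \<and>
        (\<forall>z\<in>topspace Z. H (z, 0) = p (g z)) \<longrightarrow>
        (\<exists>K. continuous_map (prod_topology Z unit_interval) E K \<and>
             (\<forall>z\<in>topspace Z. K (z, 0) = g z) \<and>
             (\<forall>z\<in>topspace Z. \<forall>t\<in>{0..1}. p (K (z, t)) = H (z, t))))"

text \<open>
  Homotopy extension property. The universal target is the mapping cylinder of \<open>i\<close>, a quotient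
  of the disjoint union of \<open>X\<close> and \<open>A \<times> [0,1]\<close>; it lives on the type \<open>'x + 'a \<times> real\<close>.
\<close>

definition cofibration ::
    "'a topology \<Rightarrow> 'x topology \<Rightarrow> ('a \<Rightarrow> 'x) \<Rightarrow> bool" where
  "cofibration A X i \<longleftrightarrow>
     continuous_map A X i \<and>
     (\<forall>(Z :: ('x + 'a \<times> real) topology) g H.
        continuous_map X Z g \<and>
        continuous_map (prod_topology A unit_interval) Z H \<and>
        (\<forall>a\<in>topspace A. H (a, 0) = g (i a)) \<longrightarrow>
        (\<exists>K. continuous_map (prod_topology X unit_interval) Z K \<and>
             (\<forall>x\<in>topspace X. K (x, 0) = g x) \<and>
             (\<forall>a\<in>topspace A. \<forall>t\<in>{0..1}. K (i a, t) = H (a, t))))"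

definition closed_cofibration ::
    "'a topology \<Rightarrow> 'x topology \<Rightarrow> ('a \<Rightarrow> 'x) \<Rightarrow> bool" where
  "closed_cofibration A X i \<longleftrightarrow> cofibration A X i \<and> closedin X (i ` topspace A)"

definition locally_equiconnected :: "'b topology \<Rightarrow> bool" where
  "locally_equiconnected B \<longleftrightarrow> closed_cofibration B (prod_topology B B) (\<lambda>b. (b, b))"

text \<open>
  Absolute neighbourhood retracts for metrizable spaces. (The library constant \<open>ANR\<close>
  is designed for subsets of Euclidean spaces.) By the Kuratowski-Wojdyslawski theorem \<open>X\<close> embeds as a
  closed subset of a convex subset of the normed space of bounded functions \<open>X \<rightarrow> \<real>\<close>. If it is
  a neighbourhood retract there, then Dugundji's extension theorem makes it a neighbourhood
  retract in every metrizable space containing it as a closed subset, of any cardinality. So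
  the ambient spaces carried by the type \<open>'a \<Rightarrow> real\<close> suffice.
\<close>

definition ANR_space :: "'a topology \<Rightarrow> bool" where
  "ANR_space X \<longleftrightarrow>
     metrizable_space X \<and>
     (\<forall>(Z :: ('a \<Rightarrow> real) topology) e.
        metrizable_space Z \<and> embedding_map X Z e \<and> closedin Z (e ` topspace X) \<longrightarrow>
        (\<exists>W. openin Z W \<and> e ` topspace X \<subseteq> W \<and>
             (e ` topspace X) retract_of_space (subtopology Z W)))"

definition fibrewise_pointed_space ::
    "'b topology \<Rightarrow> 'x topology \<Rightarrow> ('x \<Rightarrow> 'b) \<Rightarrow> ('b \<Rightarrow> 'x) \<Rightarrow> bool" where
  "fibrewise_pointed_space B X p s \<longleftrightarrow>
     continuous_map X B p \<and> continuous_map B X s \<and> (\<forall>b\<in>topspace B. p (s b) = b)"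

definition fibrewise_pointed_map ::
    "'b topology \<Rightarrow> 'x topology \<Rightarrow> ('x \<Rightarrow> 'b) \<Rightarrow> ('b \<Rightarrow> 'x) \<Rightarrow>
     'y topology \<Rightarrow> ('y \<Rightarrow> 'b) \<Rightarrow> ('b \<Rightarrow> 'y) \<Rightarrow> ('x \<Rightarrow> 'y) \<Rightarrow> bool" where
  "fibrewise_pointed_map B X pX sX Y pY sY f \<longleftrightarrow>
     continuous_map X Y f \<and>
     (\<forall>x\<in>topspace X. pY (f x) = pX x) \<and>
     (\<forall>b\<in>topspace B. f (sX b) = sY b)"

definition fibrewise_homotopic ::
    "'x topology \<Rightarrow> ('x \<Rightarrow> 'b) \<Rightarrow> 'y topology \<Rightarrow> ('y \<Rightarrow> 'b) \<Rightarrow>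
     ('x \<Rightarrow> 'y) \<Rightarrow> ('x \<Rightarrow> 'y) \<Rightarrow> bool" where
  "fibrewise_homotopic X pX Y pY f g \<longleftrightarrow>
     homotopic_with (\<lambda>h. \<forall>x\<in>topspace X. pY (h x) = pX x) X Y f g"

definition fibrewise_pointed_homotopic ::
    "'b topology \<Rightarrow> 'x topology \<Rightarrow> ('x \<Rightarrow> 'b) \<Rightarrow> ('b \<Rightarrow> 'x) \<Rightarrow>
     'y topology \<Rightarrow> ('y \<Rightarrow> 'b) \<Rightarrow> ('b \<Rightarrow> 'y) \<Rightarrow> ('x \<Rightarrow> 'y) \<Rightarrow> ('x \<Rightarrow> 'y) \<Rightarrow> bool" where
  "fibrewise_pointed_homotopic B X pX sX Y pY sY f g \<longleftrightarrow>
     homotopic_with (\<lambda>h. (\<forall>x\<in>topspace X. pY (h x) = pX x) \<and> (\<forall>b\<in>topspace B. h (sX b) = sY b))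
       X Y f g"

text \<open>
  The maps are \<open>f 1, \<dots>, f r\<close>. Infima are taken in \<^typ>\<open>enat\<close>, so the value is the least such
  \<open>n\<close>, and \<open>\<infinity>\<close> if there is none.
\<close>

definition fibrewise_distance ::
    "'x topology \<Rightarrow> ('x \<Rightarrow> 'b) \<Rightarrow> 'y topology \<Rightarrow> ('y \<Rightarrow> 'b) \<Rightarrow>
     nat \<Rightarrow> (nat \<Rightarrow> 'x \<Rightarrow> 'y) \<Rightarrow> enat" where
  "fibrewise_distance X pX Y pY r f =
     Inf {enat n | n. \<exists>U :: nat \<Rightarrow> 'x set.
            (\<forall>i\<le>n. openin X (U i)) \<and> (\<Union>i\<le>n. U i) = topspace X \<and>
            (\<forall>i\<le>n. \<forall>s\<in>{1..r}. \<forall>t\<in>{1..r}.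
               fibrewise_homotopic (subtopology X (U i)) pX Y pY (f s) (f t))}"

definition fibrewise_pointed_distance ::
    "'b topology \<Rightarrow> 'x topology \<Rightarrow> ('x \<Rightarrow> 'b) \<Rightarrow> ('b \<Rightarrow> 'x) \<Rightarrow>
     'y topology \<Rightarrow> ('y \<Rightarrow> 'b) \<Rightarrow> ('b \<Rightarrow> 'y) \<Rightarrow> nat \<Rightarrow> (nat \<Rightarrow> 'x \<Rightarrow> 'y) \<Rightarrow> enat" where
  "fibrewise_pointed_distance B X pX sX Y pY sY r f =
     Inf {enat n | n. \<exists>U :: nat \<Rightarrow> 'x set.
            (\<forall>i\<le>n. openin X (U i)) \<and> (\<Union>i\<le>n. U i) = topspace X \<and>
            (\<forall>i\<le>n. sX ` topspace B \<subseteq> U i) \<and>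
            (\<forall>i\<le>n. \<forall>s. 1 \<le> s \<and> s < r \<longrightarrow>
               fibrewise_pointed_homotopic B (subtopology X (U i)) pX sX Y pY sY
                 (f s) (f (Suc s)))}"

end

theory Submission
  imports Defs
begin

text \<open>
  The left inequality forgets base points. For the right one it suffices to find an open
  neighbourhood \<open>N\<close> of the section of \<open>X\<close> that can be deformed onto the section inside the fibres of
  \<open>X\<close>, with the section fixed (lemma \<open>vertical_contraction_near_section\<close>). On such an \<open>N\<close> every pointed
  fibrewise map is pointed homotopic to \<open>sY \<circ> pX\<close>, hence all the \<open>f j\<close> are pointed homotopic on \<open>N\<close>.
  Given a cover by sets \<open>U i\<close> on which the maps are unpointed homotopic, choose by normality an open
  \<open>V\<close> that contains the section and whose closure \<open>C\<close> lies in \<open>N\<close>. The sets \<open>(U i - C) \<union> V\<close> are disjoint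
  unions: on \<open>U i - C\<close>, which misses the section, the given homotopies are good enough, and on
  \<open>V \<subseteq> N\<close> there are pointed ones. These sets cover everything outside \<open>C\<close>, and \<open>N\<close> covers \<open>C\<close>, so one
  additional set is enough.

  To construct \<open>N\<close>, points near the diagonal of \<open>X\<close> are joined by paths that depend continuously on
  their endpoints and are constant on the diagonal; this is where \<open>X\<close> being an ANR enters
  (\<open>ANR_space_imp_local_connecting_map\<close>). The path from \<open>x\<close> to the base point of its fibre need not
  stay in that fibre, but its projection to \<open>B\<close> is a small loop. Local equiconnectedness of \<open>B\<close>
  contracts this loop (\<open>locally_equiconnected_imp_local_connecting_map\<close>), and the fibration property
  of \<open>X\<close> lifts the contraction and so pushes the path into the fibre. The lift has to keep the ends of the path
  and the points of the section fixed; \<open>hurewicz_fibration_lift_stationary\<close> achieves this because all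
  these points form the zero set of a continuous function, by which the homotopy can be
  reparametrised.
\<close>

section \<open>Continuous maps and products with the unit interval\<close>

lemma continuous_map_compose':
  assumes "continuous_map Y Z g" "continuous_map X Y f"
  shows "continuous_map X Z (\<lambda>x. g (f x))"
  using continuous_map_compose[OF assms(2,1)] by (simp add: o_def)

lemma continuous_map_fst':
  "continuous_map Z (prod_topology X Y) f \<Longrightarrow> continuous_map Z X (\<lambda>z. fst (f z))"
  by (rule continuous_map_compose'[OF continuous_map_fst])

lemma continuous_map_snd':
  "continuous_map Z (prod_topology X Y) f \<Longrightarrow> continuous_map Z Y (\<lambda>z. snd (f z))"
  by (rule continuous_map_compose'[OF continuous_map_snd])

lemma continuous_map_snd_real:
  "continuous_map (prod_topology X unit_interval) euclideanreal snd"
  using continuous_map_snd continuous_map_in_subtopology by blast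

text \<open>
  Compactness of the interval makes the projection along it closed; this is the tube lemma in
  the form in which the neighbourhoods below are shrunk.
\<close>

lemma openin_Collect_ball_unit_interval:
  assumes "openin (prod_topology X unit_interval) W"
  shows "openin X {x \<in> topspace X. \<forall>t\<in>{0..1}. (x, t) \<in> W}"
proof -
  let ?P = "prod_topology X unit_interval"
  have "compact_space unit_interval"
    by (simp add: compact_space_subtopology)
  then have "closedin X (fst ` (topspace ?P - W))"
    using closed_map_fst[of unit_interval X] assms
    unfolding closed_map_def by blast
  moreover have "{x \<in> topspace X. \<forall>t\<in>{0..1}. (x, t) \<in> W}
      = topspace X - fst ` (topspace ?P - W)"
    by (force simp: image_iff)
  ultimately show ?thesis
    by auto
qed

section \<open>Lifting homotopies that are stationary on a zero set\<close>

lemma hurewicz_fibrationD: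
  fixes Z :: "('e \<times> (real \<Rightarrow> 'b)) topology" and E :: "'e topology" and B :: "'b topology"
  assumes "hurewicz_fibration E B p" "continuous_map Z E g"
    and "continuous_map (prod_topology Z unit_interval) B H"
    and "\<forall>z\<in>topspace Z. H (z, 0) = p (g z)"
  shows "\<exists>K. continuous_map (prod_topology Z unit_interval) E K \<and>
           (\<forall>z\<in>topspace Z. K (z, 0) = g z) \<and>
           (\<forall>z\<in>topspace Z. \<forall>t\<in>{0..1}. p (K (z, t)) = H (z, t))"
  using assms unfolding hurewicz_fibration_def by blast

text \<open>
  The lifting property for test spaces on \<open>'e \<times> real\<close>, the type that carries the product of a
  subspace of \<open>E\<close> with an interval. If \<open>'b\<close> has two distinct elements, real numbers can be coded as
  functions \<open>real \<Rightarrow> 'b\<close> and the test space can be transported; if \<open>'b\<close> has only one element, every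
  map to \<open>B\<close> is constant and the constant homotopy is a lift.
\<close>

lemma hurewicz_fibration_lift:
  fixes Z :: "('e \<times> real) topology" and E :: "'e topology" and B :: "'b topology"
  assumes fib: "hurewicz_fibration E B p"
    and g: "continuous_map Z E g"
    and H: "continuous_map (prod_topology Z unit_interval) B H"
    and H0: "\<And>z. z \<in> topspace Z \<Longrightarrow> H (z, 0) = p (g z)"
  obtains K where "continuous_map (prod_topology Z unit_interval) E K"
    "\<And>z. z \<in> topspace Z \<Longrightarrow> K (z, 0) = g z"
    "\<And>z t. z \<in> topspace Z \<Longrightarrow> t \<in> {0..1} \<Longrightarrow> p (K (z, t)) = H (z, t)"
proof (cases "\<exists>a b :: 'b. a \<noteq> b")
  case True
  then obtain a b :: 'b where ab: "a \<noteq> b" by blast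
  define j :: "'e \<times> real \<Rightarrow> 'e \<times> (real \<Rightarrow> 'b)"
    where "j z = (fst z, \<lambda>t. if t = snd z then a else b)" for z
  have "inj j"
    unfolding inj_def j_def using ab by (auto simp: fun_eq_iff prod_eq_iff)
  define k where "k = inv j"
  have kj: "k (j z) = z" for z
    using \<open>inj j\<close> by (simp add: k_def)
  define Z' where "Z' = pullback_topology UNIV k Z"
  have k_cont: "continuous_map Z' Z k"
    using continuous_map_pullback[OF continuous_map_id, of UNIV k Z] by (simp add: Z'_def)
  have j_cont: "continuous_map Z Z' j"
    unfolding Z'_def
    by (rule continuous_map_pullback') (auto simp: o_def kj)
  let ?I = unit_interval
  have g': "continuous_map Z' E (\<lambda>w. g (k w))"
    by (rule continuous_map_compose'[OF g k_cont])
  have H': "continuous_map (prod_topology Z' ?I) B (\<lambda>w. H (k (fst w), snd w))"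
    by (intro continuous_map_compose'[OF H] continuous_map_pairedI
        continuous_map_compose'[OF k_cont] continuous_map_fst continuous_map_snd)
  have top: "k w \<in> topspace Z" if "w \<in> topspace Z'" for w
    using k_cont that by (auto simp: continuous_map_def)
  have "\<forall>w\<in>topspace Z'. H (k (fst (w, 0)), snd (w, 0)) = p (g (k w))"
    using H0 top by simp
  note hurewicz_fibrationD[OF fib g' H' this]
  then obtain K where K: "continuous_map (prod_topology Z' ?I) E K"
    "\<forall>w\<in>topspace Z'. K (w, 0) = g (k w)"
    "\<forall>w\<in>topspace Z'. \<forall>t\<in>{0..1}. p (K (w, t)) = H (k w, t)"
    by auto
  have jtop: "j z \<in> topspace Z'" if "z \<in> topspace Z" for z
    using j_cont that by (auto simp: continuous_map_def)
  show ?thesis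
  proof
    show "continuous_map (prod_topology Z ?I) E (\<lambda>w. K (j (fst w), snd w))"
      by (intro continuous_map_compose'[OF K(1)] continuous_map_pairedI
          continuous_map_compose'[OF j_cont] continuous_map_fst continuous_map_snd)
  qed (use K jtop kj in auto)
next
  case False
  then have eq: "x = y" for x y :: 'b by blast
  show ?thesis
  proof
    show "continuous_map (prod_topology Z unit_interval) E (\<lambda>w. g (fst w))"
      by (rule continuous_map_compose'[OF g continuous_map_fst])
  qed (auto intro: eq)
qed

text \<open>
  Running \<open>H (z, \<cdot>)\<close> so fast that it is finished at time \<open>\<phi> z\<close> and waiting afterwards is continuous even
  where \<open>\<phi>\<close> vanishes, because there \<open>H\<close> does not move and whole nearby tracks stay near its value.
  At a zero of \<open>\<phi>\<close> the quotient is \<open>0\<close> by convention, which selects the starting point.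
\<close>

lemma continuous_map_speed_up:
  fixes \<phi> :: "'z \<Rightarrow> real"
  assumes H: "continuous_map (prod_topology Z unit_interval) B H"
    and \<phi>: "continuous_map Z euclideanreal \<phi>"
    and \<phi>01: "\<And>z. z \<in> topspace Z \<Longrightarrow> 0 \<le> \<phi> z"
    and stat: "\<And>z t. \<lbrakk>z \<in> topspace Z; \<phi> z = 0; t \<in> {0..1}\<rbrakk> \<Longrightarrow> H (z, t) = H (z, 0)"
  shows "continuous_map (prod_topology Z unit_interval) B
           (\<lambda>w. H (fst w, min (snd w / \<phi> (fst w)) 1))" (is "continuous_map ?P B ?H'")
  unfolding continuous_map_def
proof (intro conjI allI impI)
  have in_P: "(z, min (t / \<phi> z) 1) \<in> topspace ?P" if "(z, t) \<in> topspace ?P" for z t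
    using that \<phi>01 by auto
  have Htop: "H w \<in> topspace B" if "w \<in> topspace ?P" for w
    using H that by (auto simp: continuous_map_def)
  show "?H' \<in> topspace ?P \<rightarrow> topspace B"
    using in_P by (intro Pi_I Htop) force
next
  fix V assume V: "openin B V"
  let ?S = "{w \<in> topspace ?P. ?H' w \<in> V}"
  show "openin ?P ?S"
  proof (subst openin_subopen, intro ballI)
    fix w assume w: "w \<in> ?S"
    obtain z t where [simp]: "w = (z, t)" by (cases w)
    have z: "z \<in> topspace Z" and t: "t \<in> {0..1}" using w by auto
    show "\<exists>T. openin ?P T \<and> w \<in> T \<and> T \<subseteq> ?S"
    proof (cases "\<phi> z = 0")
      case False
      \<comment> \<open>Away from the zero set of \<open>\<phi>\<close> the new map is a composite of continuous maps.\<close>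
      define O1 where "O1 = {z \<in> topspace Z. \<phi> z \<in> {0<..}}"
      have O1: "openin Z O1"
        unfolding O1_def by (rule openin_continuous_map_preimage[OF \<phi>]) auto
      let ?Q = "prod_topology (subtopology Z O1) unit_interval"
      have f1: "continuous_map ?Q Z fst"
        using continuous_map_fst continuous_map_in_subtopology by blast
      have "continuous_map ?Q euclideanreal (\<lambda>w. min (snd w / \<phi> (fst w)) 1)"
        by (intro continuous_intros continuous_map_snd_real continuous_map_compose'[OF \<phi> f1])
          (auto simp: O1_def)
      then have "continuous_map ?Q unit_interval (\<lambda>w. min (snd w / \<phi> (fst w)) 1)"
        by (rule continuous_map_into_subtopology) (auto simp: O1_def)
      then have "continuous_map ?Q B ?H'"
        by (intro continuous_map_compose'[OF H] continuous_map_pairedI f1)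
      then have "openin ?Q {w \<in> topspace ?Q. ?H' w \<in> V}"
        using V by (rule openin_continuous_map_preimage)
      moreover have "?Q = subtopology ?P (O1 \<times> {0..1})"
        by (simp add: prod_topology_subtopology(1))
      moreover have "openin ?P (O1 \<times> {0..1})"
        using O1 openin_topspace[of unit_interval] by (simp add: openin_prod_Times_iff)
      ultimately have "openin ?P {w \<in> topspace ?Q. ?H' w \<in> V}"
        by (metis (lifting) openin_trans_full)
      moreover have "z \<in> O1"
        using False \<phi>01[OF z] z by (auto simp: O1_def)
      ultimately show ?thesis
        using w t O1 by (intro exI[of _ "{w \<in> topspace ?Q. ?H' w \<in> V}"]) auto
    next
      case True
      \<comment> \<open>Over the zero set the whole track of \<open>z\<close> lies in \<open>V\<close>, hence so do all nearby tracks.\<close>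
      define O2 where
        "O2 = {z \<in> topspace Z. \<forall>t\<in>{0..1}. (z, t) \<in> {w \<in> topspace ?P. H w \<in> V}}"
      have "openin Z O2"
        unfolding O2_def
        by (intro openin_Collect_ball_unit_interval openin_continuous_map_preimage[OF H V])
      then have "openin ?P (O2 \<times> {0..1})"
        using openin_topspace[of unit_interval] by (simp add: openin_prod_Times_iff)
      moreover have "z \<in> O2"
      proof -
        have "H (z, 0) \<in> V"
          using w True by simp
        then have "H (z, u) \<in> V" if "u \<in> {0..1}" for u
          using stat[OF z True that] by simp
        then show ?thesis
          using z by (auto simp: O2_def)
      qed
      moreover have "O2 \<times> {0..1} \<subseteq> ?S"
      proof
        fix w' assume "w' \<in> O2 \<times> {0..1::real}"
        then obtain z' t' where [simp]: "w' = (z', t')" and *: "z' \<in> O2" "t' \<in> {0..1}"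
          by blast
        then have "z' \<in> topspace Z" by (auto simp: O2_def)
        with * \<phi>01[of z'] have "min (t' / \<phi> z') 1 \<in> {0..1}" by auto
        with * \<open>z' \<in> topspace Z\<close> show "w' \<in> ?S" by (auto simp: O2_def)
      qed
      ultimately show ?thesis
        using t by (intro exI[of _ "O2 \<times> {0..1}"]) auto
    qed
  qed
qed

text \<open>
  A homotopy that is stationary on the zero set of a real function \<open>\<phi>\<close> has a lift that is
  stationary there: lift the homotopy that is finished at time \<open>\<phi> z\<close>, then reparametrise the lift by
  \<open>u \<mapsto> u * \<phi> z\<close>. Where \<open>\<phi>\<close> vanishes, the reparametrised lift never leaves time \<open>0\<close>.
\<close>

lemma hurewicz_fibration_lift_stationary:
  fixes Z :: "('e \<times> real) topology" and E :: "'e topology" and B :: "'b topology"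
  assumes fib: "hurewicz_fibration E B p"
    and g: "continuous_map Z E g"
    and H: "continuous_map (prod_topology Z unit_interval) B H"
    and H0: "\<And>z. z \<in> topspace Z \<Longrightarrow> H (z, 0) = p (g z)"
    and \<phi>: "continuous_map Z euclideanreal \<phi>"
    and \<phi>01: "\<And>z. z \<in> topspace Z \<Longrightarrow> \<phi> z \<in> {0..1}"
    and stat: "\<And>z t. \<lbrakk>z \<in> topspace Z; \<phi> z = 0; t \<in> {0..1}\<rbrakk> \<Longrightarrow> H (z, t) = H (z, 0)"
  obtains K where "continuous_map (prod_topology Z unit_interval) E K"
    "\<And>z. z \<in> topspace Z \<Longrightarrow> K (z, 0) = g z"
    "\<And>z t. \<lbrakk>z \<in> topspace Z; t \<in> {0..1}\<rbrakk> \<Longrightarrow> p (K (z, t)) = H (z, t)"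
    "\<And>z t. \<lbrakk>z \<in> topspace Z; \<phi> z = 0; t \<in> {0..1}\<rbrakk> \<Longrightarrow> K (z, t) = g z"
proof -
  let ?P = "prod_topology Z unit_interval"
  let ?H' = "\<lambda>w. H (fst w, min (snd w / \<phi> (fst w)) 1)"
  have H': "continuous_map ?P B ?H'"
    using continuous_map_speed_up[OF H \<phi> _ stat] \<phi>01 by auto
  obtain K where K: "continuous_map ?P E K"
    "\<And>z. z \<in> topspace Z \<Longrightarrow> K (z, 0) = g z"
    "\<And>z t. z \<in> topspace Z \<Longrightarrow> t \<in> {0..1} \<Longrightarrow> p (K (z, t)) = ?H' (z, t)"
    using hurewicz_fibration_lift[OF fib g H'] H0 by auto
  show thesis
  proof
    have "continuous_map ?P euclideanreal (\<lambda>w. snd w * \<phi> (fst w))"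
      by (intro continuous_intros continuous_map_snd_real
          continuous_map_compose'[OF \<phi> continuous_map_fst])
    moreover have "snd w * \<phi> (fst w) \<in> {0..1}" if "w \<in> topspace ?P" for w
      using that \<phi>01[of "fst w"] by (auto simp: mult_le_one)
    ultimately have "continuous_map ?P unit_interval (\<lambda>w. snd w * \<phi> (fst w))"
      by (intro continuous_map_into_subtopology) auto
    then show "continuous_map ?P E (\<lambda>w. K (fst w, snd w * \<phi> (fst w)))"
      by (intro continuous_map_compose'[OF K(1)] continuous_map_pairedI continuous_map_fst)
    fix z t assume z: "z \<in> topspace Z" and t: "t \<in> {0..1::real}"
    have "t * \<phi> z \<in> {0..1}"
      using \<phi>01[OF z] t by (auto intro: mult_le_one)
    then show "p (K (fst (z, t), snd (z, t) * \<phi> (fst (z, t)))) = H (z, t)"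
      using K(3)[OF z, of "t * \<phi> z"] stat[OF z _ t] t by (cases "\<phi> z = 0") simp_all
  qed (use K(2) in auto)
qed

section \<open>Local connecting maps\<close>

text \<open>
  A choice of path \<open>\<mu> ((x, y), \<cdot>)\<close> from \<open>x\<close> to \<open>y\<close> for all \<open>(x, y)\<close> in a neighbourhood \<open>W\<close> of the
  diagonal, continuous in all variables and constant on the diagonal. This is the only form in
  which the two local hypotheses, on the total space and on the base, enter the argument.
\<close>

definition local_connecting_map ::
    "'a topology \<Rightarrow> ('a \<times> 'a) set \<Rightarrow> (('a \<times> 'a) \<times> real \<Rightarrow> 'a) \<Rightarrow> bool" where
  "local_connecting_map X W \<mu> \<longleftrightarrow>
     openin (prod_topology X X) W \<and> (\<forall>x\<in>topspace X. (x, x) \<in> W) \<and>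
     continuous_map (prod_topology (subtopology (prod_topology X X) W) unit_interval) X \<mu> \<and>
     (\<forall>x y. (x, y) \<in> W \<longrightarrow> \<mu> ((x, y), 0) = x \<and> \<mu> ((x, y), 1) = y) \<and>
     (\<forall>x\<in>topspace X. \<forall>t\<in>{0..1}. \<mu> ((x, x), t) = x)"

text \<open>
  The homotopy extension property gives a retraction of \<open>B \<times> B \<times> [0,1]\<close> onto the mapping cylinder
  of the diagonal. It moves \<open>(x, y)\<close> to a point \<open>(R\<^sub>1, R\<^sub>2, R\<^sub>3)\<close> which starts as \<open>(x, y, 0)\<close> and which,
  for \<open>(x, y)\<close> near the diagonal, ends with \<open>R\<^sub>3 > 0\<close>, hence with \<open>R\<^sub>1 = R\<^sub>2\<close>. So the paths \<open>R\<^sub>1\<close> from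
  \<open>x\<close> and \<open>R\<^sub>2\<close> from \<open>y\<close> end at the same point and can be joined. The mapping cylinder is realised as
  the subset \<open>T\<close> of \<open>B \<times> B \<times> [0,1]\<close> and carried over to the type over which the targets of
  cofibrations range by pulling its topology back along a surjection \<open>j\<close>.
\<close>

lemma locally_equiconnected_imp_local_connecting_map:
  fixes B :: "'b topology"
  assumes "locally_equiconnected B"
  obtains W \<mu> where "local_connecting_map B W \<mu>"
proof -
  let ?I = unit_interval
  let ?BB = "prod_topology B B"
  define T where "T = subtopology (prod_topology ?BB ?I) {w. snd w = 0 \<or> fst (fst w) = snd (fst w)}"
  define j :: "('b \<times> 'b) + 'b \<times> real \<Rightarrow> ('b \<times> 'b) \<times> real"
    where "j = case_sum (\<lambda>w. (w, 0)) (\<lambda>(b, t). ((b, b), t))"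
  define Z where "Z = pullback_topology UNIV j T"
  have j_cont: "continuous_map Z T j"
    using continuous_map_pullback[OF continuous_map_id, of UNIV j T] by (simp add: Z_def)
  \<comment> \<open>\<open>j\<close> identifies \<open>Inl (b, b)\<close> with \<open>Inr (b, 0)\<close>, but the homotopy has to agree literally with
    \<open>Inl\<close> at time \<open>0\<close>; hence the case distinction.\<close>
  define H :: "'b \<times> real \<Rightarrow> ('b \<times> 'b) + 'b \<times> real"
    where "H w = (if snd w = 0 then Inl (fst w, fst w) else Inr w)" for w
  have jH: "j \<circ> H = (\<lambda>w. ((fst w, fst w), snd w))"
    by (auto simp: j_def H_def fun_eq_iff)
  have jI: "j \<circ> Inl = (\<lambda>x. (x, 0))"
    by (auto simp: j_def fun_eq_iff)
  have "continuous_map ?BB T (j \<circ> Inl)"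
    unfolding T_def jI
    by (rule continuous_map_into_subtopology)
      (simp_all add: continuous_map_paired continuous_map_in_subtopology)
  then have gZ: "continuous_map ?BB Z Inl"
    unfolding Z_def by (rule continuous_map_pullback') auto
  have "continuous_map (prod_topology B ?I) T (j \<circ> H)"
    unfolding T_def jH
    by (rule continuous_map_into_subtopology)
      (simp_all add: continuous_map_paired continuous_map_fst continuous_map_snd)
  then have HZ: "continuous_map (prod_topology B ?I) Z H"
    unfolding Z_def by (rule continuous_map_pullback') auto
  have "cofibration B ?BB (\<lambda>b. (b, b))"
    using assms by (simp add: locally_equiconnected_def closed_cofibration_def)
  moreover have Hg: "\<forall>a\<in>topspace B. H (a, 0) = Inl (a, a)"
    by (simp add: H_def)
  ultimately obtain K where K: "continuous_map (prod_topology ?BB ?I) Z K"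
    and K0: "\<forall>x\<in>topspace ?BB. K (x, 0) = Inl x"
    and Kd: "\<forall>b\<in>topspace B. \<forall>t\<in>{0..1}. K ((b, b), t) = H (b, t)"
    unfolding cofibration_def using gZ HZ Hg by blast
  define R where "R w = j (K w)" for w
  have "continuous_map (prod_topology ?BB ?I) T R"
    unfolding R_def by (rule continuous_map_compose'[OF j_cont K])
  then have R: "continuous_map (prod_topology ?BB ?I) (prod_topology ?BB ?I) R"
    and R_T: "\<And>w. w \<in> topspace (prod_topology ?BB ?I) \<Longrightarrow>
        snd (R w) = 0 \<or> fst (fst (R w)) = snd (fst (R w))"
    by (auto simp: T_def continuous_map_in_subtopology)
  have R0: "R (x, 0) = (x, 0)" if "x \<in> topspace ?BB" for x
    using bspec[OF K0 that] by (simp add: R_def j_def)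
  have Rd: "R ((b, b), t) = ((b, b), t)" if "b \<in> topspace B" "t \<in> {0..1}" for b t
    using Kd that by (auto simp: R_def j_def H_def)
  define W where "W = {x \<in> topspace ?BB. snd (R (x, 1)) \<in> {0<..}}"
  have c1: "continuous_map ?BB (prod_topology ?BB ?I) (\<lambda>x. (x, 1))"
    by (simp add: continuous_map_paired continuous_map_in_subtopology)
  have "continuous_map ?BB euclideanreal (\<lambda>x. snd (R (x, 1)))"
    by (rule continuous_map_compose'[OF continuous_map_snd_real continuous_map_compose'[OF R c1]])
  then have W: "openin ?BB W"
    unfolding W_def by (rule openin_continuous_map_preimage) auto
  have meet: "fst (fst (R (x, 1))) = snd (fst (R (x, 1)))" if "x \<in> W" for x
    using R_T[of "(x, 1)"] that by (auto simp: W_def)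
  \<comment> \<open>Follow the first coordinate of the retraction forwards, then the second one backwards.\<close>
  define \<mu> where "\<mu> w = (if snd w \<le> 1/2 then fst (fst (R (fst w, 2 * snd w)))
      else snd (fst (R (fst w, 2 - 2 * snd w))))" for w
  let ?Q = "prod_topology (subtopology ?BB W) ?I"
  have sndQ: "continuous_map ?Q euclideanreal snd"
    by (rule continuous_map_snd_real)
  have fstQ: "continuous_map ?Q ?BB fst"
    using continuous_map_fst continuous_map_in_subtopology by blast
  have \<mu>: "continuous_map ?Q B \<mu>"
    unfolding \<mu>_def
  proof (rule continuous_map_cases_le)
    show "continuous_map ?Q euclideanreal snd" by fact
    let ?S = "{w \<in> topspace ?Q. snd w \<le> 1/2}"
    have "continuous_map (subtopology ?Q ?S) ?I (\<lambda>w. 2 * snd w)"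
      by (rule continuous_map_into_subtopology)
        (auto intro!: continuous_intros continuous_map_from_subtopology[OF sndQ])
    then show "continuous_map (subtopology ?Q ?S) B (\<lambda>w. fst (fst (R (fst w, 2 * snd w))))"
      by (intro continuous_map_fst'[OF continuous_map_fst'[OF continuous_map_compose'[OF R]]]
          continuous_map_pairedI continuous_map_from_subtopology[OF fstQ])
    let ?S' = "{w \<in> topspace ?Q. 1/2 \<le> snd w}"
    have "continuous_map (subtopology ?Q ?S') ?I (\<lambda>w. 2 - 2 * snd w)"
      by (rule continuous_map_into_subtopology)
        (auto intro!: continuous_intros continuous_map_from_subtopology[OF sndQ])
    then show "continuous_map (subtopology ?Q ?S') B (\<lambda>w. snd (fst (R (fst w, 2 - 2 * snd w))))"
      by (intro continuous_map_snd'[OF continuous_map_fst'[OF continuous_map_compose'[OF R]]]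
          continuous_map_pairedI continuous_map_from_subtopology[OF fstQ])
    show "fst (fst (R (fst w, 2 * snd w))) = snd (fst (R (fst w, 2 - 2 * snd w)))"
      if "w \<in> topspace ?Q" "snd w = 1/2" for w
    proof -
      have "fst w \<in> W" using that(1) by auto
      moreover have "2 * snd w = 1" "2 - 2 * snd w = 1" using that(2) by auto
      ultimately show ?thesis using meet by presburger
    qed
  qed auto
  show thesis
  proof
    show "local_connecting_map B W \<mu>"
      unfolding local_connecting_map_def
    proof (intro conjI allI impI ballI)
      show "(b, b) \<in> W" if "b \<in> topspace B" for b
        using that Rd[of b 1] by (auto simp: W_def)
      show "\<mu> ((x, y), 0) = x" "\<mu> ((x, y), 1) = y" if "(x, y) \<in> W" for x y
        using that R0[of "(x, y)"] by (auto simp: W_def \<mu>_def)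
      show "\<mu> ((b, b), t) = b" if "b \<in> topspace B" "t \<in> {0..1}" for b t
        using that Rd[of b "2 * t"] Rd[of b "2 - 2 * t"] by (auto simp: \<mu>_def)
    qed (use W \<mu> in auto)
  qed
qed

text \<open>
  Embed \<open>X\<close> isometrically into the bounded functions on \<open>X\<close> by \<open>x \<mapsto> d x\<close>, where \<open>d \<le> 1\<close> (the
  Kuratowski embedding), and let \<open>Z\<close> be the union of all line segments between two points of the
  image. The image is closed in \<open>Z\<close>, so it is a retract of a neighbourhood \<open>V\<close>. For \<open>(x, y)\<close> near the
  diagonal the whole segment from \<open>x\<close> to \<open>y\<close> lies in \<open>V\<close>, and the retraction turns it into a path in
  \<open>X\<close>.
\<close>

lemma ANR_space_imp_local_connecting_map:
  fixes X :: "'a topology"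
  assumes "ANR_space X"
  obtains W \<mu> where "local_connecting_map X W \<mu>"
proof (cases "topspace X = {}")
  case True
  have "local_connecting_map X {} (\<lambda>w. fst (fst w))"
    by (simp add: local_connecting_map_def True prod_topology_subtopology)
  then show ?thesis by (rule that)
next
  case nonempty: False
  have "metrizable_space X"
    using assms by (simp add: ANR_space_def)
  then obtain m0 :: "'a metric" where "X = mtopology_of m0"
    by (metis Metric_space.mtopology_of metrizable_space_def)
  define m where "m = capped_metric 1 m0"
  have Xm: "X = mtopology_of m"
    by (simp add: m_def mtopology_capped_metric \<open>X = mtopology_of m0\<close>)
  define M where "M = mspace m"
  define d where "d = mdist m"
  interpret Metric_space M d
    unfolding M_def d_def by simp
  have XM: "X = mtopology"
    by (simp add: Xm mtopology_of_def M_def d_def)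
  then have topX [simp]: "topspace X = M" by simp
  have M_ne: "M \<noteq> {}" using nonempty by simp
  have d_le1: "d x y \<le> 1" for x y
    by (simp add: d_def m_def mdist_capped)
  have d_tri: "\<bar>d x w - d y w\<bar> \<le> d x y" if "x \<in> M" "y \<in> M" "w \<in> M" for x y w
    using triangle[of x y w] triangle[of y x w] that commute[of x y] by linarith
  \<comment> \<open>The segment from \<open>x\<close> to \<open>y\<close> in the space of bounded functions on \<open>X\<close>.\<close>
  define u :: "('a \<times> 'a) \<times> real \<Rightarrow> 'a \<Rightarrow> real" where
    "u q = (\<lambda>w\<in>M. (1 - snd q) * d (fst (fst q)) w + snd q * d (snd (fst q)) w)" for q
  let ?MM = "M \<times> M"
  let ?D = "?MM \<times> {0..1::real}"
  let ?F = "funspace M (euclidean_metric :: real metric)"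
  have u_val: "0 \<le> u q w \<and> u q w \<le> 1" if "q \<in> ?D" "w \<in> M" for q w
  proof -
    have "0 \<le> snd q" "0 \<le> 1 - snd q"
      using that by auto
    then have "(1 - snd q) * d (fst (fst q)) w + snd q * d (snd (fst q)) w
        \<le> (1 - snd q) * 1 + snd q * 1"
      by (intro add_mono mult_left_mono d_le1)
    with \<open>0 \<le> snd q\<close> \<open>0 \<le> 1 - snd q\<close> that show ?thesis
      by (simp add: u_def)
  qed
  have uF: "u q \<in> mspace ?F" if "q \<in> ?D" for q
  proof -
    have "u q ` M \<subseteq> {0..1}"
      using u_val[OF that] by auto
    then have "bounded (u q ` M)"
      using bounded_closed_interval bounded_subset by blast
    then show ?thesis
      by (simp add: Met_TC.fspace_def u_def)
  qed
  have dist_le: "mdist ?F (u q) (u q') \<le> a \<longleftrightarrow> (\<forall>w\<in>M. \<bar>u q w - u q' w\<bar> \<le> a)"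
    if "q \<in> ?D" "q' \<in> ?D" for q q' a
    using Urysohn.funspace_mdist_le[OF uF[OF that(1)] uF[OF that(2)] M_ne, of a] by (simp add: dist_real_def)
  have u_Lip: "mdist ?F (u ((x, y), t)) (u ((x', y'), t')) \<le> d x x' + d y y' + \<bar>t - t'\<bar>"
    if "x \<in> M" "y \<in> M" "x' \<in> M" "y' \<in> M" "t \<in> {0..1}" "t' \<in> {0..1}" for x y x' y' t t'
  proof -
    have "\<bar>u ((x, y), t) w - u ((x', y'), t') w\<bar> \<le> d x x' + d y y' + \<bar>t - t'\<bar>" if "w \<in> M" for w
    proof -
      have "u ((x, y), t) w - u ((x', y'), t') w
          = (1 - t) * (d x w - d x' w) + t * (d y w - d y' w) + (t - t') * (d y' w - d x' w)"
        using \<open>w \<in> M\<close> by (simp add: u_def algebra_simps)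
      also have "\<bar>\<dots>\<bar> \<le> \<bar>1 - t\<bar> * \<bar>d x w - d x' w\<bar> + \<bar>t\<bar> * \<bar>d y w - d y' w\<bar> + \<bar>t - t'\<bar> * \<bar>d y' w - d x' w\<bar>"
        unfolding abs_mult[symmetric] by linarith
      also have "\<dots> \<le> 1 * d x x' + 1 * d y y' + \<bar>t - t'\<bar> * 1"
      proof (intro add_mono mult_mono)
        show "\<bar>d y' w - d x' w\<bar> \<le> 1"
          using d_le1[of y' w] d_le1[of x' w] nonneg[of y' w] nonneg[of x' w] by linarith
      qed (use \<open>x \<in> M\<close> \<open>y \<in> M\<close> \<open>x' \<in> M\<close> \<open>y' \<in> M\<close> \<open>t \<in> {0..1}\<close> \<open>w \<in> M\<close> d_tri in auto)
      finally show ?thesis by simp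
    qed
    then show ?thesis
      by (subst dist_le) (use that in auto)
  qed
  let ?P = "prod_topology (prod_topology X X) unit_interval"
  have topP: "topspace ?P = ?D" by simp
  have u_cont: "continuous_map ?P (mtopology_of ?F) u"
    unfolding mtopology_of_def
  proof (subst Metric_space.continuous_map_to_metric[OF Metric_space_mspace_mdist], intro ballI allI impI)
    fix q and \<epsilon> :: real assume q: "q \<in> topspace ?P" and "0 < \<epsilon>"
    obtain x y t where q_eq: "q = ((x, y), t)" by (metis surj_pair)
    have xyt: "x \<in> M" "y \<in> M" "t \<in> {0..1}" using q unfolding topP q_eq by auto
    let ?c = "\<lambda>q'. d x (fst (fst q')) + d y (snd (fst q')) + \<bar>t - snd q'\<bar>"
    have dX: "continuous_map X euclideanreal (d a)" if "a \<in> M" for a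
      unfolding Xm d_def using that by (intro continuous_on_mdist) (simp add: M_def)
    have c: "continuous_map ?P X (\<lambda>q. fst (fst q))" "continuous_map ?P X (\<lambda>q. snd (fst q))"
      by (rule continuous_map_fst'[OF continuous_map_fst] continuous_map_snd'[OF continuous_map_fst])+
    have "continuous_map ?P euclideanreal ?c"
      by (intro continuous_map_add continuous_map_real_abs continuous_map_diff
          continuous_map_snd_real continuous_map_compose'[OF dX] c xyt) simp
    then have "openin ?P {q' \<in> topspace ?P. ?c q' \<in> {..<\<epsilon>}}"
      by (rule openin_continuous_map_preimage) auto
    moreover have "u q' \<in> Metric_space.mball (mspace ?F) (mdist ?F) (u q) \<epsilon>"
      if "q' \<in> {q' \<in> topspace ?P. ?c q' \<in> {..<\<epsilon>}}" for q'
    proof -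
      obtain x' y' t' where q'_eq: "q' = ((x', y'), t')" by (metis surj_pair)
      have x'y't': "x' \<in> M" "y' \<in> M" "t' \<in> {0..1}" using that unfolding topP q'_eq by auto
      have "mdist ?F (u q) (u q') < \<epsilon>"
        using u_Lip[OF xyt(1,2) x'y't'(1,2) xyt(3) x'y't'(3)] that unfolding q_eq q'_eq by simp
      then show ?thesis
        using uF[of q] uF[of q'] xyt x'y't'
        by (simp add: Metric_space.in_mball[OF Metric_space_mspace_mdist] q_eq q'_eq del: mspace_funspace mdist_funspace)
    qed
    moreover have "q \<in> {q' \<in> topspace ?P. ?c q' \<in> {..<\<epsilon>}}"
      using xyt \<open>0 < \<epsilon>\<close> unfolding topP q_eq by simp
    ultimately show "\<exists>U. openin ?P U \<and> q \<in> U \<and>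
        (\<forall>q'\<in>U. u q' \<in> Metric_space.mball (mspace ?F) (mdist ?F) (u q) \<epsilon>)"
      by blast
  qed
  define e where "e x = u ((x, x), 0)" for x
  have e_seg: "u ((x, x), t) = e x" for x t
    by (simp add: e_def u_def fun_eq_iff algebra_simps)
  have u0: "u ((x, y), 0) = e x" and u1: "u ((x, y), 1) = e y" for x y
    by (simp_all add: e_def u_def fun_eq_iff)
  have e_val: "e x w = d x w" if "w \<in> M" for x w
    using that by (simp add: e_def u_def)
  have e_dist: "mdist ?F (e x) (e y) = d x y" if "x \<in> M" "y \<in> M" for x y
  proof (rule antisym)
    show "mdist ?F (e x) (e y) \<le> d x y"
      unfolding e_def by (subst dist_le) (use that d_tri e_val e_def in auto)
    have "mdist ?F (u ((x, x), 0)) (u ((y, y), 0)) \<le> mdist ?F (e x) (e y)"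
      by (simp add: e_def)
    then have "\<bar>u ((x, x), 0) y - u ((y, y), 0) y\<bar> \<le> mdist ?F (e x) (e y)"
      using dist_le[of "((x, x), 0)" "((y, y), 0)"] that by simp
    then show "d x y \<le> mdist ?F (e x) (e y)"
      using that e_val[of y x] e_val[of y y] by (simp add: e_def)
  qed
  define Z where "Z = subtopology (mtopology_of ?F) (u ` ?D)"
  have "metrizable_space Z"
    unfolding Z_def
    unfolding mtopology_of_def
    by (intro metrizable_space_subtopology Metric_space.metrizable_space_mtopology
        Metric_space_mspace_mdist)
  have topZ: "topspace Z = u ` ?D"
    unfolding Z_def using uF by auto
  have e_in: "e x \<in> topspace Z" if "x \<in> M" for x
    unfolding topZ e_def by (rule imageI) (use that in auto)
  have "Metric_space12 M d (mspace ?F) (mdist ?F)"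
    by (intro Metric_space12.intro Metric_space_axioms Metric_space_mspace_mdist)
  then have "embedding_map X (mtopology_of ?F) e"
    unfolding XM mtopology_of_def
    by (rule Metric_space12.isometry_imp_embedding_map) (use e_dist uF e_def in auto)
  then have emb: "embedding_map X Z e"
    unfolding Z_def embedding_map_in_subtopology using e_in topZ by auto
  \<comment> \<open>If \<open>u\<close> at \<open>((x, y), t)\<close> is within \<open>\<epsilon>\<close> of \<open>e w\<close>, evaluation at \<open>w\<close> shows that \<open>w\<close> is close to
    \<open>x\<close> or to \<open>y\<close>, according to which end of the segment is nearer.\<close>
  have near: "mdist ?F (e (if t \<le> 1/2 then x else y)) (u ((x, y), t)) \<le> 3 * mdist ?F (e w) (u ((x, y), t))"
    if "x \<in> M" "y \<in> M" "t \<in> {0..1}" "w \<in> M" for x y t w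
  proof -
    let ?\<epsilon> = "mdist ?F (e w) (u ((x, y), t))"
    let ?z = "if t \<le> 1/2 then x else y"
    have "\<bar>u ((w, w), 0) w - u ((x, y), t) w\<bar> \<le> ?\<epsilon>"
      using dist_le[of "((w, w), 0)" "((x, y), t)" ?\<epsilon>] that unfolding e_def by auto
    then have *: "(1 - t) * d x w + t * d y w \<le> ?\<epsilon>"
      using that by (simp add: u_def)
    have "d ?z w \<le> 2 * ?\<epsilon>"
    proof (cases "t \<le> 1/2")
      case True
      then have "1/2 * d x w \<le> (1 - t) * d x w" by (intro mult_right_mono) auto
      moreover have "0 \<le> t * d y w" using that by simp
      ultimately show ?thesis using * True by simp
    next
      case False
      then have "1/2 * d y w \<le> t * d y w" by (intro mult_right_mono) auto
      moreover have "0 \<le> (1 - t) * d x w" using that by simp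
      ultimately show ?thesis using * False by simp
    qed
    moreover have "mdist ?F (e ?z) (u ((x, y), t)) \<le> mdist ?F (e ?z) (e w) + ?\<epsilon>"
      by (intro mdist_triangle uF[unfolded mspace_funspace[symmetric]])
        (use that uF e_def in auto)
    moreover have "mdist ?F (e ?z) (e w) = d ?z w"
      using that by (intro e_dist) auto
    ultimately show ?thesis by linarith
  qed
  have closed: "closedin Z (e ` M)"
  proof -
    have "z \<in> e ` M" if z: "z \<in> Z closure_of (e ` M)" for z
    proof -
      have "z \<in> topspace Z" using subsetD[OF closure_of_subset_topspace z] .
      then obtain x y t where z_eq: "z = u ((x, y), t)" and xyt: "x \<in> M" "y \<in> M" "t \<in> {0..1}"
        unfolding topZ by auto
      let ?z = "if t \<le> 1/2 then x else y"
      have "z \<in> mtopology_of ?F closure_of (e ` M)"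
        using z unfolding Z_def by (rule subsetD[OF closure_of_subtopology_subset])
      then have "\<forall>\<epsilon>>0. \<exists>v\<in>e ` M. v \<in> Metric_space.mball (mspace ?F) (mdist ?F) z \<epsilon>"
        unfolding mtopology_of_def Metric_space.metric_closure_of[OF Metric_space_mspace_mdist]
        by blast
      then have cl: "\<exists>w\<in>M. mdist ?F z (e w) < \<epsilon>" if "\<epsilon> > 0" for \<epsilon>
        using that unfolding Metric_space.in_mball[OF Metric_space_mspace_mdist] by blast
      have "mdist ?F (e ?z) z \<le> 0"
      proof (rule field_le_epsilon)
        fix \<epsilon> :: real assume "\<epsilon> > 0"
        then obtain w where "w \<in> M" "mdist ?F z (e w) < \<epsilon> / 3"
          using cl[of "\<epsilon> / 3"] by auto
        then show "mdist ?F (e ?z) z \<le> 0 + \<epsilon>"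
          using near[OF xyt \<open>w \<in> M\<close>] mdist_commute[of ?F z "e w"] unfolding z_eq by linarith
      qed
      then have "mdist ?F (e ?z) z = 0"
        using mdist_nonneg[of ?F "e ?z" z] by linarith
      moreover have "?z \<in> M"
        using xyt by simp
      then have "e ?z \<in> mspace ?F"
        unfolding e_def by (intro uF) (simp only: mem_Times_iff fst_conv snd_conv, simp)
      moreover have "z \<in> mspace ?F"
        unfolding z_eq using xyt by (intro uF) simp
      ultimately have "e ?z = z"
        by (rule iffD1[OF Metric_space.zero[OF Metric_space_mspace_mdist], rotated 2])
      then show ?thesis using \<open>?z \<in> M\<close> by (metis imageI)
    qed
    then have "Z closure_of (e ` M) \<subseteq> e ` M" by blast
    then show ?thesis
      using closure_of_subset_eq[of "e ` M" Z] e_in by auto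
  qed
  have "\<exists>V. openin Z V \<and> e ` topspace X \<subseteq> V \<and>
      (e ` topspace X) retract_of_space (subtopology Z V)"
    using assms unfolding ANR_space_def
    by (elim conjE allE impE) (use \<open>metrizable_space Z\<close> emb closed in simp_all)
  then obtain V where V: "openin Z V" "e ` M \<subseteq> V" "(e ` M) retract_of_space (subtopology Z V)"
    by auto
  obtain \<rho> where \<rho>: "continuous_map (subtopology Z V) (subtopology (subtopology Z V) (e ` M)) \<rho>"
    and \<rho>e: "\<forall>z\<in>e ` M. \<rho> z = z"
    using V(3) by (auto simp: retract_of_space_def)
  obtain e' where e': "homeomorphic_maps X (subtopology Z (e ` M)) e e'"
    using emb by (auto simp: embedding_map_def homeomorphic_map_maps)
  have e'e: "e' (e x) = x" if "x \<in> M" for x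
    using e' that by (simp add: homeomorphic_maps_def)
  have uZ: "continuous_map ?P Z u"
    unfolding Z_def using u_cont by (intro continuous_map_into_subtopology) auto
  define W where "W = {x \<in> topspace (prod_topology X X).
      \<forall>t\<in>{0..1}. (x, t) \<in> {q \<in> topspace ?P. u q \<in> V}}"
  have W: "openin (prod_topology X X) W"
    unfolding W_def
    by (intro openin_Collect_ball_unit_interval openin_continuous_map_preimage[OF uZ V(1)])
  show ?thesis
  proof
    let ?Q = "prod_topology (subtopology (prod_topology X X) W) unit_interval"
    have "continuous_map ?Q Z u"
      unfolding prod_topology_subtopology(1) by (rule continuous_map_from_subtopology[OF uZ])
    then have u_V: "continuous_map ?Q (subtopology Z V) u"
      by (rule continuous_map_into_subtopology) (auto simp: W_def)
    have \<rho>_e: "continuous_map (subtopology Z V) (subtopology Z (e ` M)) \<rho>"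
      using \<rho> unfolding continuous_map_in_subtopology by auto
    have e'_X: "continuous_map (subtopology Z (e ` M)) X e'"
      using e' by (simp add: homeomorphic_maps_def)
    have "continuous_map ?Q X (\<lambda>q. e' (\<rho> (u q)))"
      by (rule continuous_map_compose'[OF e'_X continuous_map_compose'[OF \<rho>_e u_V]])
    then show "local_connecting_map X W (\<lambda>q. e' (\<rho> (u q)))"
      unfolding local_connecting_map_def
      using W \<rho>e e'e V(2) by (auto simp: u0 u1 e_seg W_def)
  qed
qed

section \<open>Vertical contraction of a neighbourhood of the section\<close>

text \<open>
  The connecting map of \<open>X\<close> joins each \<open>x\<close> near the section to \<open>s (p x)\<close> by a path \<open>\<gamma>\<close>, whose
  projection is a loop at \<open>p x\<close>. If that loop is small, the connecting map of \<open>B\<close> contracts it to the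
  constant loop. Lifting this contraction, starting from \<open>\<gamma>\<close>, deforms \<open>\<gamma>\<close> into a path inside the fibre.
  The contraction is stationary at both ends of \<open>\<gamma>\<close> and over the section, where \<open>\<gamma>\<close> is constant, so
  the stationary lift keeps the endpoints of \<open>\<gamma>\<close> and the section fixed.
\<close>

lemma vertical_contraction_near_section:
  assumes X: "fibrewise_pointed_space B X p s"
    and fib: "hurewicz_fibration X B p"
    and "metrizable_space X"
    and lamX: "local_connecting_map X WX lam"
    and muB: "local_connecting_map B WB \<mu>"
  obtains N H where "openin X N" "s ` topspace B \<subseteq> N"
    "continuous_map (prod_topology (subtopology X N) unit_interval) X H"
    "\<And>x. x \<in> N \<Longrightarrow> H (x, 0) = x" "\<And>x. x \<in> N \<Longrightarrow> H (x, 1) = s (p x)"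
    "\<And>x t. \<lbrakk>x \<in> N; t \<in> {0..1}\<rbrakk> \<Longrightarrow> p (H (x, t)) = p x"
    "\<And>b t. \<lbrakk>b \<in> topspace B; t \<in> {0..1}\<rbrakk> \<Longrightarrow> H (s b, t) = s b"
proof -
  let ?I = unit_interval
  have p: "continuous_map X B p" and s: "continuous_map B X s"
    and ps: "\<And>b. b \<in> topspace B \<Longrightarrow> p (s b) = b"
    using X by (auto simp: fibrewise_pointed_space_def)
  have p_in: "p x \<in> topspace B" if "x \<in> topspace X" for x
    using p that by (auto simp: continuous_map_def)
  have s_in: "s b \<in> topspace X" if "b \<in> topspace B" for b
    using s that by (auto simp: continuous_map_def)
  have sp: "continuous_map X X (\<lambda>x. s (p x))"
    by (rule continuous_map_compose'[OF s p])
  have WX: "openin (prod_topology X X) WX" "\<And>x. x \<in> topspace X \<Longrightarrow> (x, x) \<in> WX"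
    and lam: "continuous_map (prod_topology (subtopology (prod_topology X X) WX) ?I) X lam"
    and lam01: "\<And>x y. (x, y) \<in> WX \<Longrightarrow> lam ((x, y), 0) = x \<and> lam ((x, y), 1) = y"
    and lam_diag: "\<And>x t. \<lbrakk>x \<in> topspace X; t \<in> {0..1}\<rbrakk> \<Longrightarrow> lam ((x, x), t) = x"
    using lamX by (auto simp: local_connecting_map_def)
  have WB: "openin (prod_topology B B) WB" "\<And>x. x \<in> topspace B \<Longrightarrow> (x, x) \<in> WB"
    and \<mu>: "continuous_map (prod_topology (subtopology (prod_topology B B) WB) ?I) B \<mu>"
    and \<mu>01: "\<And>x y. (x, y) \<in> WB \<Longrightarrow> \<mu> ((x, y), 0) = x \<and> \<mu> ((x, y), 1) = y"
    and \<mu>_diag: "\<And>x t. \<lbrakk>x \<in> topspace B; t \<in> {0..1}\<rbrakk> \<Longrightarrow> \<mu> ((x, x), t) = x"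
    using muB by (auto simp: local_connecting_map_def)
  \<comment> \<open>A path \<open>\<gamma>\<close> in \<open>X\<close> from \<open>x\<close> to the base point of its fibre; it need not stay in the fibre.\<close>
  define N0 where "N0 = {x \<in> topspace X. (x, s (p x)) \<in> WX}"
  have N0: "openin X N0"
    unfolding N0_def using WX(1)
    by (intro openin_continuous_map_preimage[of X "prod_topology X X"])
      (auto simp: continuous_map_paired sp)
  define \<gamma> where "\<gamma> w = lam ((fst w, s (p (fst w))), snd w)" for w
  let ?Q0 = "prod_topology (subtopology X N0) ?I"
  have fst0: "continuous_map ?Q0 X fst"
    using continuous_map_fst continuous_map_in_subtopology by blast
  have "continuous_map ?Q0 (subtopology (prod_topology X X) WX) (\<lambda>w. (fst w, s (p (fst w))))"
    by (intro continuous_map_into_subtopology continuous_map_pairedI fst0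
        continuous_map_compose'[OF sp fst0]) (auto simp: N0_def)
  then have \<gamma>: "continuous_map ?Q0 X \<gamma>"
    unfolding \<gamma>_def
    by (intro continuous_map_compose'[OF lam] continuous_map_pairedI continuous_map_snd)
  have \<gamma>_fix: "\<gamma> (s b, t) = s b" if "b \<in> topspace B" "t \<in> {0..1}" for b t
    using that lam_diag[of "s b"] s_in ps by (simp add: \<gamma>_def)
  \<comment> \<open>Close to the section, the projection of \<open>\<gamma>\<close> is a loop so small that \<open>\<mu>\<close> contracts it.\<close>
  let ?V = "{w \<in> topspace ?Q0. (p (fst w), p (\<gamma> w)) \<in> WB}"
  define N where "N = {x \<in> topspace (subtopology X N0). \<forall>t\<in>{0..1}. (x, t) \<in> ?V}"
  have "continuous_map ?Q0 (prod_topology B B) (\<lambda>w. (p (fst w), p (\<gamma> w)))"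
    by (intro continuous_map_pairedI continuous_map_compose'[OF p] fst0 \<gamma>)
  then have "openin (subtopology X N0) N"
    using WB(1) unfolding N_def
    by (intro openin_Collect_ball_unit_interval openin_continuous_map_preimage)
  then have N: "openin X N"
    using N0 openin_trans_full by blast
  have N_sub: "N \<subseteq> N0" "N \<subseteq> topspace X"
    unfolding N_def by auto
  have N_WB: "(p x, p (\<gamma> (x, t))) \<in> WB" if "x \<in> N" "t \<in> {0..1}" for x t
    using that unfolding N_def by auto
  have sN: "s b \<in> N" if "b \<in> topspace B" for b
    using that s_in ps WX(2) WB(2) \<gamma>_fix by (auto simp: N_def N0_def)
  let ?Z = "prod_topology (subtopology X N) ?I"
  have Z_eq: "?Z = subtopology ?Q0 (N \<times> {0..1})"
    using N_sub by (simp add: subtopology_Times subtopology_subtopology inf.absorb2)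
  have \<gamma>Z: "continuous_map ?Z X \<gamma>" and fstZ: "continuous_map ?Z X fst"
    unfolding Z_eq by (intro continuous_map_from_subtopology \<gamma> fst0)+
  \<comment> \<open>\<open>\<mu>\<close> runs from the constant loop to \<open>p \<circ> \<gamma>\<close>; reversing it gives the contraction.\<close>
  define G where "G w = \<mu> ((p (fst (fst w)), p (\<gamma> (fst w))), 1 - snd w)" for w
  have "continuous_map ?Z (subtopology (prod_topology B B) WB) (\<lambda>z. (p (fst z), p (\<gamma> z)))"
    by (intro continuous_map_into_subtopology continuous_map_pairedI
        continuous_map_compose'[OF p] fstZ \<gamma>Z) (auto simp: N_WB)
  moreover have "continuous_map (prod_topology ?Z ?I) ?I (\<lambda>w. 1 - snd w)"
    by (intro continuous_map_into_subtopology continuous_map_diff continuous_map_snd_real) auto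
  ultimately have G: "continuous_map (prod_topology ?Z ?I) B G"
    unfolding G_def
    by (intro continuous_map_compose'[OF \<mu>] continuous_map_pairedI
        continuous_map_compose'[OF _ continuous_map_fst, of ?Z _ "\<lambda>z. (p (fst z), p (\<gamma> z))"])
  obtain m where Xm: "X = mtopology_of m"
    using \<open>metrizable_space X\<close> by (metis Metric_space.mtopology_of metrizable_space_def)
  \<comment> \<open>\<open>\<phi>\<close> vanishes exactly where the lift has to stay put: at both ends of \<open>\<gamma>\<close> and on the section,
    whose points are the fixed points of \<open>s \<circ> p\<close>.\<close>
  define \<phi> where "\<phi> z = min (min (snd z) (1 - snd z)) (mdist m (fst z) (s (p (fst z))))" for z
  have \<phi>: "continuous_map ?Z euclideanreal \<phi>"
    unfolding \<phi>_def
    by (intro continuous_map_real_min continuous_map_diff continuous_map_snd_real continuous_map_mdist)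
      (simp_all add: fstZ continuous_map_compose'[OF sp fstZ] flip: Xm)
  have \<phi>01: "\<phi> z \<in> {0..1}" if "z \<in> topspace ?Z" for z
    using that by (auto simp: \<phi>_def)
  have \<phi>0: "snd z = 0 \<or> snd z = 1 \<or> s (p (fst z)) = fst z"
    if "z \<in> topspace ?Z" "\<phi> z = 0" for z
  proof -
    have "fst z \<in> mspace m" "s (p (fst z)) \<in> mspace m"
      using that(1) s_in p_in N_sub Xm by auto
    then show ?thesis
      using that(2) by (auto simp: \<phi>_def min_def split: if_splits)
  qed
  have G0: "G (z, 0) = p (\<gamma> z)" if "z \<in> topspace ?Z" for z
    using that \<mu>01[OF N_WB] by (auto simp: G_def)
  have \<gamma>0: "\<gamma> (x, 0) = x" and \<gamma>1: "\<gamma> (x, 1) = s (p x)" if "x \<in> N" for x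
    using that N_sub lam01[of x "s (p x)"] by (auto simp: \<gamma>_def N0_def)
  have G_stat: "G (z, u) = G (z, 0)" if "z \<in> topspace ?Z" "\<phi> z = 0" "u \<in> {0..1}" for z u
  proof -
    obtain x t where "z = (x, t)" by (cases z)
    then have z: "z = (x, t)" "x \<in> N" "t \<in> {0..1}" "p x \<in> topspace B"
      using that(1) p_in by auto
    have "p (\<gamma> z) = p x"
      using \<phi>0[OF that(1,2)] z \<gamma>0[OF z(2)] \<gamma>1[OF z(2)] ps \<gamma>_fix[of "p x" t] by auto
    then show ?thesis
      using z that(3) \<mu>_diag[of "p x"] by (simp add: G_def)
  qed
  have "\<exists>K. continuous_map (prod_topology ?Z ?I) X K \<and>
      (\<forall>z\<in>topspace ?Z. \<forall>u\<in>{0..1}. p (K (z, u)) = G (z, u)) \<and>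
      (\<forall>z\<in>topspace ?Z. \<forall>u\<in>{0..1}. \<phi> z = 0 \<longrightarrow> K (z, u) = \<gamma> z)"
  proof (rule hurewicz_fibration_lift_stationary[OF fib \<gamma>Z G G0 \<phi> \<phi>01 G_stat], goal_cases)
    case (6 K)
    then show ?case by (intro exI[of _ K] conjI ballI impI)
  qed
  then obtain K where K: "continuous_map (prod_topology ?Z ?I) X K"
    "\<And>z u. \<lbrakk>z \<in> topspace ?Z; u \<in> {0..1}\<rbrakk> \<Longrightarrow> p (K (z, u)) = G (z, u)"
    "\<And>z u. \<lbrakk>z \<in> topspace ?Z; \<phi> z = 0; u \<in> {0..1}\<rbrakk> \<Longrightarrow> K (z, u) = \<gamma> z"
    by blast
  show thesis
  proof
    show "openin X N" by fact
    show "s ` topspace B \<subseteq> N" using sN by auto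
    have "continuous_map ?Z (prod_topology ?Z ?I) (\<lambda>z. (z, 1))"
      by (simp add: continuous_map_paired continuous_map_in_subtopology del: prod_topology_subtopology_eu)
    then show "continuous_map ?Z X (\<lambda>z. K (z, 1))"
      by (rule continuous_map_compose'[OF K(1)])
    have K_\<gamma>: "K ((x, t), 1) = \<gamma> (x, t)" if "x \<in> N" "t \<in> {0..1}" "t = 0 \<or> t = 1 \<or> s (p x) = x" for x t
    proof (rule K(3))
      have "x \<in> mspace m" using that N_sub Xm by auto
      then have "mdist m x x = 0" by simp
      then show "\<phi> (x, t) = 0"
        using that mdist_nonneg[of m x "s (p x)"] by (auto simp: \<phi>_def min_def)
    qed (use that N_sub in auto)
    show "K ((x, 0), 1) = x" "K ((x, 1), 1) = s (p x)" if "x \<in> N" for x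
      using that K_\<gamma>[of x 0] K_\<gamma>[of x 1] \<gamma>0 \<gamma>1 by auto
    show "p (K ((x, t), 1)) = p x" if "x \<in> N" "t \<in> {0..1}" for x t
      using that K(2)[of "(x, t)" 1] N_sub \<mu>01[OF N_WB[OF that]] by (auto simp: G_def)
    show "K ((s b, t), 1) = s b" if "b \<in> topspace B" "t \<in> {0..1}" for b t
      using that K_\<gamma>[of "s b" t] sN ps \<gamma>_fix by simp
  qed
qed

section \<open>Fibrewise homotopies on open subsets\<close>

lemma fibrewise_homotopic_subset:
  assumes "fibrewise_homotopic (subtopology X U) pX Y pY f g" "V \<subseteq> U"
  shows "fibrewise_homotopic (subtopology X V) pX Y pY f g"
proof -
  obtain h where h: "continuous_map (prod_topology unit_interval (subtopology X U)) Y h"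
    "\<forall>x. h (0, x) = f x" "\<forall>x. h (1, x) = g x"
    "\<forall>t\<in>{0..1}. \<forall>x\<in>topspace (subtopology X U). pY (h (t, x)) = pX x"
    using assms(1) by (auto simp: fibrewise_homotopic_def homotopic_with_def)
  have sub: "prod_topology unit_interval (subtopology X V)
      = subtopology (prod_topology unit_interval (subtopology X U)) ({0..1} \<times> V)"
    using assms(2) by (simp add: subtopology_Times subtopology_subtopology inf.absorb2)
  have "continuous_map (prod_topology unit_interval (subtopology X V)) Y h"
    unfolding sub by (rule continuous_map_from_subtopology[OF h(1)])
  then show ?thesis
    unfolding fibrewise_homotopic_def homotopic_with_def
    by (intro exI[of _ h] conjI ballI) (use h assms(2) in auto)
qed

lemma fibrewise_pointed_homotopic_subset:
  assumes "fibrewise_pointed_homotopic B (subtopology X U) pX sX Y pY sY f g" "V \<subseteq> U"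
  shows "fibrewise_pointed_homotopic B (subtopology X V) pX sX Y pY sY f g"
proof -
  obtain h where h: "continuous_map (prod_topology unit_interval (subtopology X U)) Y h"
    "\<forall>x. h (0, x) = f x" "\<forall>x. h (1, x) = g x"
    "\<forall>t\<in>{0..1}. \<forall>x\<in>topspace (subtopology X U). pY (h (t, x)) = pX x"
    "\<forall>t\<in>{0..1}. \<forall>b\<in>topspace B. h (t, sX b) = sY b"
    using assms(1) by (auto simp: fibrewise_pointed_homotopic_def homotopic_with_def)
  have sub: "prod_topology unit_interval (subtopology X V)
      = subtopology (prod_topology unit_interval (subtopology X U)) ({0..1} \<times> V)"
    using assms(2) by (simp add: subtopology_Times subtopology_subtopology inf.absorb2)
  have "continuous_map (prod_topology unit_interval (subtopology X V)) Y h"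
    unfolding sub by (rule continuous_map_from_subtopology[OF h(1)])
  then show ?thesis
    unfolding fibrewise_pointed_homotopic_def homotopic_with_def
    by (intro exI[of _ h] conjI ballI) (use h assms(2) in auto)
qed

text \<open>
  On a disjoint union, only the piece that contains the section has to respect base points. This
  is what turns the unpointed homotopies of a given cover into pointed ones.
\<close>

lemma fibrewise_pointed_homotopic_disjoint_Un:
  assumes U: "openin X U" and V: "openin X V" and disj: "U \<inter> V = {}"
    and sV: "sX ` topspace B \<subseteq> V"
    and homU: "fibrewise_homotopic (subtopology X U) pX Y pY f g"
    and homV: "fibrewise_pointed_homotopic B (subtopology X V) pX sX Y pY sY f g"
  shows "fibrewise_pointed_homotopic B (subtopology X (U \<union> V)) pX sX Y pY sY f g"
proof -
  let ?I = unit_interval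
  obtain h where h: "continuous_map (prod_topology ?I (subtopology X U)) Y h"
    "\<forall>x. h (0, x) = f x" "\<forall>x. h (1, x) = g x"
    "\<forall>t\<in>{0..1}. \<forall>x\<in>topspace (subtopology X U). pY (h (t, x)) = pX x"
    using homU by (auto simp: fibrewise_homotopic_def homotopic_with_def)
  obtain k where k: "continuous_map (prod_topology ?I (subtopology X V)) Y k"
    "\<forall>x. k (0, x) = f x" "\<forall>x. k (1, x) = g x"
    "\<forall>t\<in>{0..1}. \<forall>x\<in>topspace (subtopology X V). pY (k (t, x)) = pX x"
    "\<forall>t\<in>{0..1}. \<forall>b\<in>topspace B. k (t, sX b) = sY b"
    using homV by (auto simp: fibrewise_pointed_homotopic_def homotopic_with_def)
  let ?l = "\<lambda>w. if snd w \<in> V then k w else h w"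
  let ?P = "prod_topology ?I (subtopology X (U \<union> V))"
  have sub: "subtopology ?P ({0..1} \<times> S) = prod_topology ?I (subtopology X S)"
    if "S \<subseteq> U \<union> V" for S
    using that by (simp add: subtopology_Times subtopology_subtopology inf.absorb2)
  have "continuous_map ?P Y ?l"
  proof (rule pasting_lemma[where I = UNIV and T = "\<lambda>i. {0..1} \<times> (if i then V else U)"
        and f = "\<lambda>i. if i then k else h"])
    fix i :: bool
    have "openin (subtopology X (U \<union> V)) (if i then V else U)"
      using U V by (simp add: openin_open_subtopology openin_Un)
    then show "openin ?P ({0..1} \<times> (if i then V else U))"
      using openin_topspace[of ?I] by (simp add: openin_prod_Times_iff)
    show "continuous_map (subtopology ?P ({0..1} \<times> (if i then V else U))) Y (if i then k else h)"
      using h(1) k(1) by (cases i) (simp_all add: sub)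
    show "(if i then k else h) w = (if j then k else h) w"
      if "w \<in> topspace ?P \<inter> {0..1} \<times> (if i then V else U) \<inter> {0..1} \<times> (if j then V else U)"
      for j w
      using that disj by (cases i; cases j) auto
  next
    fix w assume w: "w \<in> topspace ?P"
    show "\<exists>j. j \<in> UNIV \<and> w \<in> {0..1} \<times> (if j then V else U) \<and> ?l w = (if j then k else h) w"
      using w by (intro exI[of _ "snd w \<in> V"]) (auto simp: mem_Times_iff)
  qed
  moreover have "sX b \<in> V" if "b \<in> topspace B" for b
    using sV that by auto
  ultimately show ?thesis
    unfolding fibrewise_pointed_homotopic_def homotopic_with_def
    using h k by (intro exI[of _ ?l]) auto
qed

text \<open>
  Precomposing a pointed map \<open>f\<close> with a vertical contraction onto the section joins it to
  \<open>sY \<circ> pX\<close>, which does not depend on \<open>f\<close>; so any two pointed maps are homotopic on \<open>N\<close>.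
\<close>

lemma fibrewise_pointed_homotopic_contract:
  assumes f: "fibrewise_pointed_map B X pX sX Y pY sY f"
    and pX: "continuous_map X B pX"
    and N: "openin X N" "sX ` topspace B \<subseteq> N"
    and H: "continuous_map (prod_topology (subtopology X N) unit_interval) X H"
    and H0: "\<And>x. x \<in> N \<Longrightarrow> H (x, 0) = x" and H1: "\<And>x. x \<in> N \<Longrightarrow> H (x, 1) = sX (pX x)"
    and Hp: "\<And>x t. \<lbrakk>x \<in> N; t \<in> {0..1}\<rbrakk> \<Longrightarrow> pX (H (x, t)) = pX x"
    and Hs: "\<And>b t. \<lbrakk>b \<in> topspace B; t \<in> {0..1}\<rbrakk> \<Longrightarrow> H (sX b, t) = sX b"
  shows "fibrewise_pointed_homotopic B (subtopology X N) pX sX Y pY sY f (\<lambda>x. sY (pX x))"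
proof -
  let ?XN = "subtopology X N"
  let ?Q = "prod_topology unit_interval ?XN"
  have fY: "continuous_map X Y f" and fp: "\<And>x. x \<in> topspace X \<Longrightarrow> pY (f x) = pX x"
    and fs: "\<And>b. b \<in> topspace B \<Longrightarrow> f (sX b) = sY b"
    using f by (auto simp: fibrewise_pointed_map_def)
  have N_top: "x \<in> topspace X" if "x \<in> N" for x
    using openin_subset[OF N(1)] that by auto
  have s_top: "sX b \<in> topspace ?XN" if "b \<in> topspace B" for b
    using N(2) N_top that by auto
  have p_top: "pX x \<in> topspace B" if "x \<in> N" for x
    using pX N_top[OF that] by (auto simp: continuous_map_def)
  have H_top: "H (x, t) \<in> topspace X" if "x \<in> N" "t \<in> {0..1}" for x t
    using H that N_top by (auto simp: continuous_map_def)
  have cont: "continuous_map ?Q Y (\<lambda>w. f (H (snd w, fst w)))"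
    by (intro continuous_map_compose'[OF fY] continuous_map_compose'[OF H] continuous_map_pairedI
        continuous_map_fst continuous_map_snd)
  show ?thesis
    unfolding fibrewise_pointed_homotopic_def
  proof (subst homotopic_with)
    show "((\<forall>x\<in>topspace ?XN. pY (h x) = pX x) \<and> (\<forall>b\<in>topspace B. h (sX b) = sY b)) =
        ((\<forall>x\<in>topspace ?XN. pY (k x) = pX x) \<and> (\<forall>b\<in>topspace B. k (sX b) = sY b))"
      if "\<And>x. x \<in> topspace ?XN \<Longrightarrow> h x = k x" for h k
      using that s_top by simp
    show "\<exists>h. continuous_map ?Q Y h \<and> (\<forall>x\<in>topspace ?XN. h (0, x) = f x) \<and>
        (\<forall>x\<in>topspace ?XN. h (1, x) = sY (pX x)) \<and>
        (\<forall>t\<in>{0..1}. (\<forall>x\<in>topspace ?XN. pY (h (t, x)) = pX x) \<and>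
          (\<forall>b\<in>topspace B. h (t, sX b) = sY b))"
      using cont H0 H1 Hp Hs fs fp p_top H_top
      by (intro exI[of _ "\<lambda>w. f (H (snd w, fst w))"]) auto
  qed
qed

text \<open>
  The pointed distance asks for homotopies between consecutive maps only, the unpointed one for
  homotopies between all pairs; forgetting base points and composing links the two.
\<close>

lemma fibrewise_pointed_homotopic_chain:
  assumes "\<And>s. 1 \<le> s \<and> s < r \<Longrightarrow>
      fibrewise_pointed_homotopic B (subtopology X U) pX sX Y pY sY (f s) (f (Suc s))"
    and map: "\<And>j. j \<in> {1..r} \<Longrightarrow> fibrewise_pointed_map B X pX sX Y pY sY (f j)"
    and s: "s \<in> {1..r}" and t: "t \<in> {1..r}"
  shows "fibrewise_homotopic (subtopology X U) pX Y pY (f s) (f t)"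
proof -
  let ?R = "fibrewise_homotopic (subtopology X U) pX Y pY"
  have next_step: "?R (f s) (f (Suc s))" if "1 \<le> s" "s < r" for s
    using assms(1)[OF conjI[OF that]]
    unfolding fibrewise_homotopic_def fibrewise_pointed_homotopic_def
    by (rule homotopic_with_mono) auto
  have refl: "?R (f s) (f s)" if "s \<in> {1..r}" for s
    using map[OF that] unfolding fibrewise_homotopic_def fibrewise_pointed_map_def
    by (auto simp: continuous_map_from_subtopology)
  have sym: "?R (f s) (f t) \<Longrightarrow> ?R (f t) (f s)" for s t
    unfolding fibrewise_homotopic_def by (rule homotopic_with_symD)
  have trans: "?R (f s) (f t) \<Longrightarrow> ?R (f t) (f u) \<Longrightarrow> ?R (f s) (f u)" for s t u
    unfolding fibrewise_homotopic_def by (rule homotopic_with_trans)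
  have up: "?R (f s) (f t)" if "s \<le> t" "1 \<le> s" "t \<le> r" for s t
    using that
  proof (induction t rule: dec_induct)
    case base
    then show ?case using refl by simp
  next
    case (step n)
    then have "?R (f s) (f n)" by simp
    moreover have "?R (f n) (f (Suc n))"
      using step by (intro next_step) auto
    ultimately show ?case by (rule trans)
  qed
  show ?thesis
    using up[of s t] sym[OF up[of t s]] s t by (cases "s \<le> t") simp_all
qed

section \<open>Comparison of the two distances\<close>

theorem theorem6p7:
  fixes B :: "'b topology" and X :: "'x topology" and Y :: "'y topology"
    and pX :: "'x \<Rightarrow> 'b" and sX :: "'b \<Rightarrow> 'x"
    and pY :: "'y \<Rightarrow> 'b" and sY :: "'b \<Rightarrow> 'y"
    and r :: nat and f :: "nat \<Rightarrow> 'x \<Rightarrow> 'y"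
  assumes "r \<ge> 1"
    and "fibrewise_pointed_space B X pX sX"
    and "fibrewise_pointed_space B Y pY sY"
    and "hurewicz_fibration X B pX"
    and "hurewicz_fibration Y B pY"
    and "\<And>j. j \<in> {1..r} \<Longrightarrow> fibrewise_pointed_map B X pX sX Y pY sY (f j)"
    and "ANR_space X"
    and "ANR_space Y"
    and "locally_equiconnected B"
  shows "fibrewise_distance X pX Y pY r f \<le> fibrewise_pointed_distance B X pX sX Y pY sY r f
    \<and> fibrewise_pointed_distance B X pX sX Y pY sY r f \<le> fibrewise_distance X pX Y pY r f + 1"
proof
  show "fibrewise_distance X pX Y pY r f \<le> fibrewise_pointed_distance B X pX sX Y pY sY r f"
    unfolding fibrewise_distance_def fibrewise_pointed_distance_def
  proof (rule Inf_superset_mono, rule subsetI, clarify)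
    fix n and U :: "nat \<Rightarrow> 'x set"
    assume U: "\<forall>i\<le>n. openin X (U i)" "(\<Union>i\<le>n. U i) = topspace X"
      and hom: "\<forall>i\<le>n. \<forall>s. 1 \<le> s \<and> s < r \<longrightarrow>
        fibrewise_pointed_homotopic B (subtopology X (U i)) pX sX Y pY sY (f s) (f (Suc s))"
    have "\<forall>i\<le>n. \<forall>s\<in>{1..r}. \<forall>t\<in>{1..r}.
        fibrewise_homotopic (subtopology X (U i)) pX Y pY (f s) (f t)"
      by (intro allI impI ballI fibrewise_pointed_homotopic_chain[where f = f and r = r, OF _ assms(6)])
        (use hom in blast)+
    then show "\<exists>m. enat n = enat m \<and> (\<exists>U. (\<forall>i\<le>m. openin X (U i)) \<and> (\<Union>i\<le>m. U i) = topspace X \<and>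
        (\<forall>i\<le>m. \<forall>s\<in>{1..r}. \<forall>t\<in>{1..r}.
          fibrewise_homotopic (subtopology X (U i)) pX Y pY (f s) (f t)))"
      using U by blast
  qed
next
  have X: "continuous_map X B pX" "continuous_map B X sX"
    using assms(2) by (auto simp: fibrewise_pointed_space_def)
  have "metrizable_space X"
    using assms(7) by (simp add: ANR_space_def)
  obtain WX lam where lam: "local_connecting_map X WX lam"
    using ANR_space_imp_local_connecting_map[OF assms(7)] .
  obtain WB \<mu> where \<mu>: "local_connecting_map B WB \<mu>"
    using locally_equiconnected_imp_local_connecting_map[OF assms(9)] .
  obtain N H where N: "openin X N" "sX ` topspace B \<subseteq> N"
    and H: "continuous_map (prod_topology (subtopology X N) unit_interval) X H"
      "\<And>x. x \<in> N \<Longrightarrow> H (x, 0) = x" "\<And>x. x \<in> N \<Longrightarrow> H (x, 1) = sX (pX x)"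
      "\<And>x t. \<lbrakk>x \<in> N; t \<in> {0..1}\<rbrakk> \<Longrightarrow> pX (H (x, t)) = pX x"
      "\<And>b t. \<lbrakk>b \<in> topspace B; t \<in> {0..1}\<rbrakk> \<Longrightarrow> H (sX b, t) = sX b"
    by (rule vertical_contraction_near_section[OF assms(2,4) \<open>metrizable_space X\<close> lam \<mu>], rule that)
  have to_section: "fibrewise_pointed_homotopic B (subtopology X N) pX sX Y pY sY (f j) (\<lambda>x. sY (pX x))"
    if "j \<in> {1..r}" for j
    by (rule fibrewise_pointed_homotopic_contract[OF assms(6)[OF that] X(1) N H])
  have homN: "fibrewise_pointed_homotopic B (subtopology X N) pX sX Y pY sY (f s) (f (Suc s))"
    if "1 \<le> s" "s < r" for s
  proof -
    have "s \<in> {1..r}" "Suc s \<in> {1..r}" using that by auto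
    note this[THEN to_section, unfolded fibrewise_pointed_homotopic_def]
    then show ?thesis
      unfolding fibrewise_pointed_homotopic_def
      using homotopic_with_trans homotopic_with_symD by blast
  qed
  have "sX ` topspace B = {x \<in> topspace X. sX (pX x) = x}"
  proof (intro equalityI subsetI)
    fix x assume "x \<in> {x \<in> topspace X. sX (pX x) = x}"
    then show "x \<in> sX ` topspace B"
      using X(1) by (intro image_eqI[of _ _ "pX x"]) (auto simp: continuous_map_def)
  next
    fix x assume "x \<in> sX ` topspace B"
    then show "x \<in> {x \<in> topspace X. sX (pX x) = x}"
      using assms(2) by (auto simp: fibrewise_pointed_space_def continuous_map_def)
  qed
  moreover have "closedin X {x \<in> topspace X. sX (pX x) = x}"
    using metrizable_imp_Hausdorff_space[OF \<open>metrizable_space X\<close>]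
    by (rule closedin_continuous_maps_eq) (auto intro: continuous_map_compose'[OF X(2,1)])
  ultimately have "closedin X (sX ` topspace B)" by simp
  then obtain V where V: "openin X V" "sX ` topspace B \<subseteq> V" "X closure_of V \<subseteq> N"
    using metrizable_imp_normal_space[OF \<open>metrizable_space X\<close>, unfolded normal_space_alt, rule_format,
        of "sX ` topspace B" N] N by auto
  have V_cl: "V \<subseteq> X closure_of V"
    by (rule closure_of_subset[OF openin_subset[OF V(1)]])
  let ?S = "{enat n | n. \<exists>U :: nat \<Rightarrow> 'x set.
            (\<forall>i\<le>n. openin X (U i)) \<and> (\<Union>i\<le>n. U i) = topspace X \<and>
            (\<forall>i\<le>n. \<forall>s\<in>{1..r}. \<forall>t\<in>{1..r}.
               fibrewise_homotopic (subtopology X (U i)) pX Y pY (f s) (f t))}"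
  have bound: "fibrewise_pointed_distance B X pX sX Y pY sY r f \<le> enat n + 1" if n: "enat n \<in> ?S" for n
  proof -
    from n obtain U :: "nat \<Rightarrow> 'x set" where U_open: "\<forall>i\<le>n. openin X (U i)"
      and U_cover: "(\<Union>i\<le>n. U i) = topspace X"
      and U_hom: "\<forall>i\<le>n. \<forall>s\<in>{1..r}. \<forall>t\<in>{1..r}.
         fibrewise_homotopic (subtopology X (U i)) pX Y pY (f s) (f t)"
      by (clarsimp simp only: mem_Collect_eq enat.inject)
    \<comment> \<open>Cut the closure of \<open>V\<close> out of \<open>U i\<close> and put \<open>V\<close> back as a separate piece; the points lost in
      this way lie in \<open>N\<close>, the additional member of the cover.\<close>
    define U' where "U' i = (if i \<le> n then (U i - X closure_of V) \<union> V else N)" for i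
    have open': "openin X (U' i)" for i
      using U_open V(1) N(1) by (auto simp: U'_def intro!: openin_Un openin_diff)
    have "topspace X \<subseteq> (\<Union>i\<le>Suc n. U' i)"
    proof
      fix x assume "x \<in> topspace X"
      then obtain i where i: "i \<le> n" "x \<in> U i" using U_cover by blast
      show "x \<in> (\<Union>i\<le>Suc n. U' i)"
      proof (cases "x \<in> X closure_of V")
        case True
        then show ?thesis using V(3) by (intro UN_I[of "Suc n"]) (auto simp: U'_def)
      next
        case False
        then show ?thesis using i by (intro UN_I[of i]) (auto simp: U'_def)
      qed
    qed
    then have cover': "(\<Union>i\<le>Suc n. U' i) = topspace X"
      using openin_subset[OF open'] by blast
    have hom': "fibrewise_pointed_homotopic B (subtopology X (U' i)) pX sX Y pY sY (f s) (f (Suc s))"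
      if "1 \<le> s" "s < r" for i s
    proof (cases "i \<le> n")
      case True
      have "fibrewise_pointed_homotopic B (subtopology X ((U i - X closure_of V) \<union> V))
          pX sX Y pY sY (f s) (f (Suc s))"
      proof (rule fibrewise_pointed_homotopic_disjoint_Un)
        show "openin X (U i - X closure_of V)"
          using U_open True by (simp add: openin_diff)
        show "fibrewise_homotopic (subtopology X (U i - X closure_of V)) pX Y pY (f s) (f (Suc s))"
          by (rule fibrewise_homotopic_subset[of _ "U i"]) (use U_hom True that in auto)
        show "fibrewise_pointed_homotopic B (subtopology X V) pX sX Y pY sY (f s) (f (Suc s))"
          by (rule fibrewise_pointed_homotopic_subset[OF homN[OF that]]) (use V(3) V_cl in auto)
      qed (use V V_cl in auto)
      then show ?thesis using True by (simp add: U'_def)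
    next
      case False
      then show ?thesis using homN[OF that] by (simp add: U'_def)
    qed
    have section': "sX ` topspace B \<subseteq> U' i" for i
      using N(2) V(2) by (auto simp: U'_def)
    have "enat (Suc n) \<in> {enat n | n. \<exists>U :: nat \<Rightarrow> 'x set.
            (\<forall>i\<le>n. openin X (U i)) \<and> (\<Union>i\<le>n. U i) = topspace X \<and>
            (\<forall>i\<le>n. sX ` topspace B \<subseteq> U i) \<and>
            (\<forall>i\<le>n. \<forall>s. 1 \<le> s \<and> s < r \<longrightarrow>
               fibrewise_pointed_homotopic B (subtopology X (U i)) pX sX Y pY sY
                 (f s) (f (Suc s)))}"
      by (intro CollectI exI[of _ "Suc n"] conjI refl exI[of _ U'] allI impI open' cover' section' hom')
        simp_all
    then have "fibrewise_pointed_distance B X pX sX Y pY sY r f \<le> enat (Suc n)"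
      unfolding fibrewise_pointed_distance_def by (rule Inf_lower)
    then show ?thesis by (simp add: one_enat_def)
  qed
  show "fibrewise_pointed_distance B X pX sX Y pY sY r f \<le> fibrewise_distance X pX Y pY r f + 1"
  proof (cases "?S = {}")
    case True
    then have "fibrewise_distance X pX Y pY r f = \<infinity>"
      unfolding fibrewise_distance_def by (simp add: Inf_enat_def)
    then show ?thesis by simp
  next
    case False
    then obtain k where "k \<in> ?S" by (meson all_not_in_conv)
    then have Inf_in: "Inf ?S \<in> ?S" by (rule wellorder_InfI)
    then obtain n where n: "Inf ?S = enat n" by (elim CollectE exE conjE)
    show ?thesis
      unfolding fibrewise_distance_def n by (rule bound) (use Inf_in in \<open>simp only: n\<close>)
  qed
qed

end
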